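(* Let $\mathcal{P}$ be a convex set of probability measures on a measurable space, and let $G\colon\mathcal{P}\to\mathbb{R}$ be a strictly convex, lower semicontinuous function with a subgradient $S\colon\mathcal{P}\to\mathcal{L}(\mathcal{P})$. Then $d_{G^*,S^{-1}}\colon S(\mathcal{P})\times\mathrm{co}(S(\mathcal{P}))\to\mathbb{R}$, $$d_{G^*,S^{-1}}(p',q')=G^*(q')-G^*(p')-(q'-p')\cdot S^{-1}(p'),$$ is a (well-defined) restricted functional Bregman divergence, and: (1) for all $p,q\in\mathcal{P}$: $d_{G,S}(p,q)=d_{G^*,S^{-1}}(S(q),S(p))$; (2) for all $p',q'\in S(\mathcal{P})$: $d_{G^*,S^{-1}}(p',q')=d_{G,S}(S^{-1}(q'),S^{-1}(p'))$; (3) for every $p'\in S(\mathcal{P})$ and every random element $Q'$ with values in $S(\mathcal{P})$ such that $|\mathbb{E}[Q'\cdot P]|<\infty$ for all $P\in\mathcal{P}$, $\mathbb{E}[Q']\in\mathrm{co}(S(\mathcal{P}))$, and $\mathbb{E}[G^*(Q')]$ exists (is finite): $$\mathbb{E}\left[d_{G^*,S^{-1}}(p',Q')\right]=\mathbb{B}_{G^*}[Q']+d_{G^*,S^{-1}}\left(p',\mathbb{E}[Q']\right).$$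
   Context: $\mathcal{L}(\mathcal{P})$ is the vector space of measurable functions $f$ with $\int|f|\,\mathrm{d}P<\infty$ for all $P\in\mathcal{P}$; $\mathrm{span}\,\mathcal{P}$ is the space of finite real linear combinations of elements of $\mathcal{P}$; the pairing is $f\cdot P=\int f\,\mathrm{d}P$. $\mathrm{co}$ denotes the convex hull, and $S(\mathcal{P})=\{S(P)\mid P\in\mathcal{P}\}$. Lower semicontinuity is with respect to a fixed topology on $\mathrm{span}\,\mathcal{P}$. $S\colon\mathcal{P}\to\mathcal{L}(\mathcal{P})$ is a subgradient of $G$ if $G(Q)\ge G(P)+S(P)\cdot(Q-P)$ for all $P,Q\in\mathcal{P}$. A subgradient of a strictly convex function is injective; $S^{-1}\colon S(\mathcal{P})\to\mathcal{P}$ is its inverse. The functional Bregman divergence generated by $(G,S)$ is $d_{G,S}(p,q)=G(q)-G(p)-S(p)\cdot(q-p)$ for $p,q\in\mathcal{P}$. General definition: for a vector space $X$ with dual vector space $X^*$ and pairing $\langle\cdot,\cdot\rangle$, a convex function $\phi\colon U\to\mathbb{R}$ on a convex set $U\subset X$, and a subset $V\subset U$, a map $\phi'_r\colon V\to X^*$ is a subgradient of $\phi$ on $V$ if $\phi(y)\ge\phi(x)+\langle\phi'_r(x),y-x\rangle$ for all $x\in V$, $y\in U$; then $d_{\phi,\phi'_r}\colon V\times U\to\mathbb{R}$, $d_{\phi,\phi'_r}(x,y)=\phi(y)-\phi(x)-\langle\phi'_r(x),y-x\rangle$, is called a restricted functional Bregman divergence. Here it is used with $\phi=G^*$, $X=\mathcal{L}(\mathcal{P})$,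 $X^*=\mathrm{span}\,\mathcal{P}$, $U=\mathrm{co}(S(\mathcal{P}))$, $V=S(\mathcal{P})$, $\phi'_r=S^{-1}$. The convex conjugate of $G$ (extended by $+\infty$ to $\mathrm{span}\,\mathcal{P}\setminus\mathcal{P}$) is $G^*(f)=\sup_{P\in\mathrm{span}\,\mathcal{P}}\left(f\cdot P-G(P)\right)$ for $f\in\mathcal{L}(\mathcal{P})$. For a random element $Q'$ of $\mathcal{L}(\mathcal{P})$, $\mathbb{E}[Q']$ denotes the element of $\mathcal{L}(\mathcal{P})$ with $\mathbb{E}[Q']\cdot P=\mathbb{E}[Q'\cdot P]$ for all $P\in\mathcal{P}$, and $\mathbb{B}_{G^*}[Q']=\mathbb{E}[G^*(Q')]-G^*(\mathbb{E}[Q'])$ is the functional Bregman Information. *)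

theory Defs
  imports "HOL-Probability.Probability" "HOL-Library.Function_Algebras"
begin

section \<open>Real functions as a vector space\<close>

instantiation "fun" :: (type, real_vector) real_vector
begin

definition scaleR_fun_def: "c *\<^sub>R f = (\<lambda>x. c *\<^sub>R f x)"

instance
  by standard (auto simp: scaleR_fun_def plus_fun_def scaleR_add_right scaleR_add_left)

end

lemma scaleR_fun_apply [simp]: "(c *\<^sub>R f) x = c *\<^sub>R f x"
  by (simp add: scaleR_fun_def)

section \<open>Probability measures and their pairing with functions\<close>

text \<open>
  A finite signed measure on a measurable space \<open>M\<close> is represented by its set function
  of type \<^typ>\<open>'a set \<Rightarrow> real\<close>, with value 0 on non-measurable sets (the convention of
  \<^const>\<open>measure\<close>). In this vector space a set of probability measures has a linear span and
  can be convex in the sense of the library. A probability measure on \<open>M\<close> is determined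
  by its set function.
\<close>

definition prob_measures :: "'a measure \<Rightarrow> ('a set \<Rightarrow> real) set" where
  "prob_measures M = measure ` {p. prob_space p \<and> sets p = sets M}"

text \<open>
  The integral of \<open>f\<close> with respect to a finite signed measure \<open>\<mu>\<close>: write \<open>\<mu> = \<nu>\<^sub>1 - \<nu>\<^sub>2\<close>
  with finite measures for which \<open>f\<close> is integrable, and take the difference of the integrals.
  The value does not depend on the decomposition, see \<open>pairing_eq\<close> below. It is meaningful
  only if a decomposition exists, which is the case for \<open>f\<close> in \<open>L_space M P\<close> and \<open>\<mu>\<close> in \<open>span P\<close>.
\<close>

definition pairing :: "'a measure \<Rightarrow> ('a \<Rightarrow> real) \<Rightarrow> ('a set \<Rightarrow> real) \<Rightarrow> real" where
  "pairing M f \<mu> = (THE r. \<exists>\<nu>\<^sub>1 \<nu>\<^sub>2.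
     finite_measure \<nu>\<^sub>1 \<and> sets \<nu>\<^sub>1 = sets M \<and> integrable \<nu>\<^sub>1 f \<and>
     finite_measure \<nu>\<^sub>2 \<and> sets \<nu>\<^sub>2 = sets M \<and> integrable \<nu>\<^sub>2 f \<and>
     \<mu> = measure \<nu>\<^sub>1 - measure \<nu>\<^sub>2 \<and>
     r = integral\<^sup>L \<nu>\<^sub>1 f - integral\<^sup>L \<nu>\<^sub>2 f)"

definition L_space :: "'a measure \<Rightarrow> ('a set \<Rightarrow> real) set \<Rightarrow> ('a \<Rightarrow> real) set" where
  "L_space M P = {f \<in> borel_measurable M.
     \<forall>p. prob_space p \<and> sets p = sets M \<and> measure p \<in> P \<longrightarrow> integrable p f}"

lemma nn_integral_sum_measures_eq:
  fixes f :: "'a \<Rightarrow> ennreal"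
  assumes s: "sets A = sets M" "sets B = sets M" "sets C = sets M" "sets D = sets M"
    and e: "\<And>X. X \<in> sets M \<Longrightarrow> emeasure A X + emeasure B X = emeasure C X + emeasure D X"
    and f: "f \<in> borel_measurable M"
  shows "nn_integral A f + nn_integral B f = nn_integral C f + nn_integral D f"
  using f
proof (induction f rule: borel_measurable_induct)
  note [measurable_cong] = s
  case (cong f g)
  have "space A = space M" "space B = space M" "space C = space M" "space D = space M"
    using s by (auto dest: sets_eq_imp_space_eq)
  then have "nn_integral A f = nn_integral A g" "nn_integral B f = nn_integral B g"
    "nn_integral C f = nn_integral C g" "nn_integral D f = nn_integral D g"
    using cong by (auto intro!: nn_integral_cong)
  with cong show ?case by simp
next
  case (set X)
  then show ?case using e s by simp
next
  note [measurable_cong] = s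
  case (mult u c)
  note [measurable] = mult.hyps(2)
  have "nn_integral A (\<lambda>x. c * u x) + nn_integral B (\<lambda>x. c * u x) = c * (nn_integral A u + nn_integral B u)"
    "nn_integral C (\<lambda>x. c * u x) + nn_integral D (\<lambda>x. c * u x) = c * (nn_integral C u + nn_integral D u)"
    by (simp_all add: nn_integral_cmult distrib_left)
  with mult show ?case by simp
next
  case (add u v)
  have *: "nn_integral K (\<lambda>x. v x + u x) = nn_integral K v + nn_integral K u"
    if "sets K = sets M" for K
  proof (rule nn_integral_add)
    show "v \<in> borel_measurable K" "u \<in> borel_measurable K"
      using add.hyps that by (auto cong: measurable_cong_sets)
  qed
  have "nn_integral A (\<lambda>x. v x + u x) + nn_integral B (\<lambda>x. v x + u x)
      = (nn_integral A u + nn_integral B u) + (nn_integral A v + nn_integral B v)"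
    unfolding *[OF s(1)] *[OF s(2)] by (simp add: ac_simps)
  also have "\<dots> = (nn_integral C u + nn_integral D u) + (nn_integral C v + nn_integral D v)"
    by (simp add: add.IH)
  finally show ?case unfolding *[OF s(3)] *[OF s(4)] by (simp add: ac_simps)
next
  note [measurable_cong] = s
  case (seq U)
  note [measurable] = seq.hyps(1)
  have sup: "nn_integral K (Sup (range U)) = (SUP i. nn_integral K (U i))"
    if [measurable_cong]: "sets K = sets M" for K
  proof -
    have "nn_integral K (Sup (range U)) = nn_integral K (\<lambda>x. SUP i. U i x)"
      by (intro arg_cong[where f = "nn_integral K"]) (auto simp: fun_eq_iff image_image)
    also have "\<dots> = (SUP i. nn_integral K (U i))"
      using seq(3) by (intro nn_integral_monotone_convergence_SUP) auto
    finally show ?thesis .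
  qed
  have inc: "incseq (\<lambda>i. nn_integral K (U i))" for K
    using seq(3) by (auto simp: incseq_def le_fun_def intro!: nn_integral_mono)
  have "nn_integral A (Sup (range U)) + nn_integral B (Sup (range U))
      = (SUP i. nn_integral A (U i) + nn_integral B (U i))"
    unfolding sup[OF s(1)] sup[OF s(2)] by (rule ennreal_SUP_add[OF inc inc, symmetric])
  also have "\<dots> = (SUP i. nn_integral C (U i) + nn_integral D (U i))"
    by (simp add: seq.IH)
  also have "\<dots> = nn_integral C (Sup (range U)) + nn_integral D (Sup (range U))"
    unfolding sup[OF s(3)] sup[OF s(4)] by (rule ennreal_SUP_add[OF inc inc])
  finally show ?case .
qed

lemma integral_sum_measures_eq:
  fixes f :: "'a \<Rightarrow> real"
  assumes s: "sets A = sets M" "sets B = sets M" "sets C = sets M" "sets D = sets M"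
    and e: "\<And>X. X \<in> sets M \<Longrightarrow> emeasure A X + emeasure B X = emeasure C X + emeasure D X"
    and i: "integrable A f" "integrable B f" "integrable C f" "integrable D f"
  shows "integral\<^sup>L A f + integral\<^sup>L B f = integral\<^sup>L C f + integral\<^sup>L D f"
proof -
  have f: "f \<in> borel_measurable M"
    using i(1) s(1) by (metis borel_measurable_integrable measurable_cong_sets)
  have *: "enn2real (nn_integral A g) + enn2real (nn_integral B g)
      = enn2real (nn_integral C g) + enn2real (nn_integral D g)"
    if g: "g \<in> borel_measurable M"
      "nn_integral A g < \<infinity>" "nn_integral B g < \<infinity>" "nn_integral C g < \<infinity>" "nn_integral D g < \<infinity>" for g
    using nn_integral_sum_measures_eq[OF s e g(1)] g(2-)
    by (metis enn2real_plus infinity_ennreal_def)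
  have fin: "nn_integral K (\<lambda>x. ennreal (f x)) < \<infinity>" "nn_integral K (\<lambda>x. ennreal (- f x)) < \<infinity>"
    if "integrable K f" for K
    using that by (auto simp: real_integrable_def less_top)
  show ?thesis
    using *[of "\<lambda>x. ennreal (f x)"] *[of "\<lambda>x. ennreal (- f x)"] fin[OF i(1)] fin[OF i(2)] fin[OF i(3)] fin[OF i(4)] f
    by (simp add: real_lebesgue_integral_def i)
qed

lemma pairing_eq:
  assumes 1: "finite_measure \<nu>\<^sub>1" "sets \<nu>\<^sub>1 = sets M" "integrable \<nu>\<^sub>1 f"
    and 2: "finite_measure \<nu>\<^sub>2" "sets \<nu>\<^sub>2 = sets M" "integrable \<nu>\<^sub>2 f"
    and \<mu>: "\<mu> = measure \<nu>\<^sub>1 - measure \<nu>\<^sub>2"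
  shows "pairing M f \<mu> = integral\<^sup>L \<nu>\<^sub>1 f - integral\<^sup>L \<nu>\<^sub>2 f"
  unfolding pairing_def
proof (rule the_equality)
  show "\<exists>\<kappa>\<^sub>1 \<kappa>\<^sub>2. finite_measure \<kappa>\<^sub>1 \<and> sets \<kappa>\<^sub>1 = sets M \<and> integrable \<kappa>\<^sub>1 f \<and>
     finite_measure \<kappa>\<^sub>2 \<and> sets \<kappa>\<^sub>2 = sets M \<and> integrable \<kappa>\<^sub>2 f \<and> \<mu> = measure \<kappa>\<^sub>1 - measure \<kappa>\<^sub>2 \<and>
     integral\<^sup>L \<nu>\<^sub>1 f - integral\<^sup>L \<nu>\<^sub>2 f = integral\<^sup>L \<kappa>\<^sub>1 f - integral\<^sup>L \<kappa>\<^sub>2 f"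
    using assms by blast
next
  fix r
  assume "\<exists>\<kappa>\<^sub>1 \<kappa>\<^sub>2. finite_measure \<kappa>\<^sub>1 \<and> sets \<kappa>\<^sub>1 = sets M \<and> integrable \<kappa>\<^sub>1 f \<and>
     finite_measure \<kappa>\<^sub>2 \<and> sets \<kappa>\<^sub>2 = sets M \<and> integrable \<kappa>\<^sub>2 f \<and> \<mu> = measure \<kappa>\<^sub>1 - measure \<kappa>\<^sub>2 \<and>
     r = integral\<^sup>L \<kappa>\<^sub>1 f - integral\<^sup>L \<kappa>\<^sub>2 f"
  then obtain \<kappa>\<^sub>1 \<kappa>\<^sub>2 where k: "finite_measure \<kappa>\<^sub>1" "sets \<kappa>\<^sub>1 = sets M" "integrable \<kappa>\<^sub>1 f"
     "finite_measure \<kappa>\<^sub>2" "sets \<kappa>\<^sub>2 = sets M" "integrable \<kappa>\<^sub>2 f" "\<mu> = measure \<kappa>\<^sub>1 - measure \<kappa>\<^sub>2"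
     "r = integral\<^sup>L \<kappa>\<^sub>1 f - integral\<^sup>L \<kappa>\<^sub>2 f" by blast
  have "measure \<nu>\<^sub>1 X + measure \<kappa>\<^sub>2 X = measure \<kappa>\<^sub>1 X + measure \<nu>\<^sub>2 X" for X
    using fun_cong[OF trans[OF \<mu>[symmetric] k(7)], of X] by simp
  then have "emeasure \<nu>\<^sub>1 X + emeasure \<kappa>\<^sub>2 X = emeasure \<kappa>\<^sub>1 X + emeasure \<nu>\<^sub>2 X" for X
    using 1 2 k by (simp add: finite_measure.emeasure_eq_measure ennreal_plus[symmetric] del: ennreal_plus)
  then have "integral\<^sup>L \<nu>\<^sub>1 f + integral\<^sup>L \<kappa>\<^sub>2 f = integral\<^sup>L \<kappa>\<^sub>1 f + integral\<^sup>L \<nu>\<^sub>2 f"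
    using 1 2 k by (intro integral_sum_measures_eq[of _ M]) auto
  with k(8) show "r = integral\<^sup>L \<nu>\<^sub>1 f - integral\<^sup>L \<nu>\<^sub>2 f" by simp
qed

lemma pairing_measure:
  assumes p: "finite_measure p" "sets p = sets M" "integrable p f"
  shows "pairing M f (measure p) = integral\<^sup>L p f"
proof -
  let ?z = "null_measure M"
  have z: "finite_measure ?z" by (auto intro!: finite_measureI)
  have f: "f \<in> borel_measurable M"
    using p by (metis borel_measurable_integrable measurable_cong_sets)
  have iz: "integrable ?z f" "integral\<^sup>L ?z f = 0"
  proof -
    have "integrable ?z f \<longleftrightarrow> integrable ?z (\<lambda>x. 0::real)"
      by (rule integrable_cong_AE) (use f in \<open>auto simp: AE_iff_null_sets null_sets_def eventually_ae_filter\<close>)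
    then show "integrable ?z f" by simp
    have "integral\<^sup>L ?z f = integral\<^sup>L ?z (\<lambda>x. 0)"
      by (rule integral_cong_AE) (use f in \<open>auto simp: eventually_ae_filter null_sets_def\<close>)
    then show "integral\<^sup>L ?z f = 0" by simp
  qed
  have "measure p = measure p - measure ?z"
    by (auto simp: fun_eq_iff measure_def)
  from pairing_eq[OF p z _ iz(1) this] iz show ?thesis by simp
qed

section \<open>Subgradients, conjugates and Bregman divergences\<close>

definition strict_convex_on :: "'x::real_vector set \<Rightarrow> ('x \<Rightarrow> real) \<Rightarrow> bool" where
  "strict_convex_on U \<phi> \<longleftrightarrow> convex U \<and>
     (\<forall>x\<in>U. \<forall>y\<in>U. \<forall>t. x \<noteq> y \<and> 0 < t \<and> t < 1 \<longrightarrow>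
        \<phi> ((1 - t) *\<^sub>R x + t *\<^sub>R y) < (1 - t) * \<phi> x + t * \<phi> y)"

definition lower_semicontinuous :: "'x topology \<Rightarrow> ('x \<Rightarrow> real) \<Rightarrow> bool" where
  "lower_semicontinuous T \<phi> \<longleftrightarrow> (\<forall>a. openin T {x \<in> topspace T. a < \<phi> x})"

text \<open>
  A vector space \<open>X\<close> and its dual space \<open>X'\<close> are given as linear subspaces of ambient types,
  together with a pairing \<open>b\<close> that is bilinear on \<open>X' \<times> X\<close>.
\<close>

definition dual_pair ::
  "'x::real_vector set \<Rightarrow> 'y::real_vector set \<Rightarrow> ('y \<Rightarrow> 'x \<Rightarrow> real) \<Rightarrow> bool" where
  "dual_pair X X' b \<longleftrightarrow> subspace X \<and> subspace X' \<and>
     (\<forall>u\<in>X'. \<forall>x\<in>X. \<forall>y\<in>X. \<forall>c d. b u (c *\<^sub>R x + d *\<^sub>R y) = c * b u x + d * b u y) \<and>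
     (\<forall>u\<in>X'. \<forall>v\<in>X'. \<forall>x\<in>X. \<forall>c d. b (c *\<^sub>R u + d *\<^sub>R v) x = c * b u x + d * b v x)"

definition subgradient_on ::
  "'y set \<Rightarrow> ('y \<Rightarrow> 'x::real_vector \<Rightarrow> real) \<Rightarrow> 'x set \<Rightarrow> 'x set \<Rightarrow> ('x \<Rightarrow> real) \<Rightarrow> ('x \<Rightarrow> 'y) \<Rightarrow> bool"
  where
  "subgradient_on X' b U V \<phi> D \<longleftrightarrow> D \<in> V \<rightarrow> X' \<and>
     (\<forall>x\<in>V. \<forall>y\<in>U. \<phi> y \<ge> \<phi> x + b (D x) (y - x))"

definition bregman ::
  "('y \<Rightarrow> 'x::real_vector \<Rightarrow> real) \<Rightarrow> ('x \<Rightarrow> real) \<Rightarrow> ('x \<Rightarrow> 'y) \<Rightarrow> 'x \<Rightarrow> 'x \<Rightarrow> real" where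
  "bregman b \<phi> D x y = \<phi> y - \<phi> x - b (D x) (y - x)"

text \<open>
  The requirements under which \<open>bregman b \<phi> D\<close>, restricted to \<open>V \<times> U\<close>, is called a restricted
  functional Bregman divergence.
\<close>

definition restricted_bregman ::
  "'x::real_vector set \<Rightarrow> 'y::real_vector set \<Rightarrow> ('y \<Rightarrow> 'x \<Rightarrow> real) \<Rightarrow>
   'x set \<Rightarrow> 'x set \<Rightarrow> ('x \<Rightarrow> real) \<Rightarrow> ('x \<Rightarrow> 'y) \<Rightarrow> bool" where
  "restricted_bregman X X' b U V \<phi> D \<longleftrightarrow>
     dual_pair X X' b \<and> U \<subseteq> X \<and> V \<subseteq> U \<and> convex_on U \<phi> \<and> subgradient_on X' b U V \<phi> D"

text \<open>
  In the supremum, \<open>G\<close> is extended by \<open>\<infinity>\<close> from \<open>P\<close> to \<open>span P\<close>; the conjugate itself may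
  take infinite values.
\<close>

definition conjugate ::
  "'a measure \<Rightarrow> ('a set \<Rightarrow> real) set \<Rightarrow> (('a set \<Rightarrow> real) \<Rightarrow> real) \<Rightarrow> ('a \<Rightarrow> real) \<Rightarrow> ereal" where
  "conjugate M P G f =
     (SUP \<mu>\<in>span P. ereal (pairing M f \<mu>) - (if \<mu> \<in> P then ereal (G \<mu>) else \<infinity>))"

text \<open>The conjugate as a real function, for arguments at which it is finite.\<close>

definition conjugate_real ::
  "'a measure \<Rightarrow> ('a set \<Rightarrow> real) set \<Rightarrow> (('a set \<Rightarrow> real) \<Rightarrow> real) \<Rightarrow> ('a \<Rightarrow> real) \<Rightarrow> real" where
  "conjugate_real M P G f = real_of_ereal (conjugate M P G f)"

definition bregman_primal ::
  "'a measure \<Rightarrow> (('a set \<Rightarrow> real) \<Rightarrow> real) \<Rightarrow> (('a set \<Rightarrow> real) \<Rightarrow> ('a \<Rightarrow> real)) \<Rightarrow>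
   ('a set \<Rightarrow> real) \<Rightarrow> ('a set \<Rightarrow> real) \<Rightarrow> real" where
  "bregman_primal M G S = bregman (pairing M) G S"

definition bregman_conjugate ::
  "'a measure \<Rightarrow> ('a set \<Rightarrow> real) set \<Rightarrow> (('a set \<Rightarrow> real) \<Rightarrow> real) \<Rightarrow>
   (('a set \<Rightarrow> real) \<Rightarrow> ('a \<Rightarrow> real)) \<Rightarrow> ('a \<Rightarrow> real) \<Rightarrow> ('a \<Rightarrow> real) \<Rightarrow> real" where
  "bregman_conjugate M P G S =
     bregman (\<lambda>\<mu> f. pairing M f \<mu>) (conjugate_real M P G) (inv_into P S)"

section \<open>Random elements of the function space\<close>

text \<open>
  \<open>m\<close> is an expectation of the random element \<open>Q\<close>, defined on the probability space \<open>N\<close>.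
  Since \<open>P\<close> need not separate the points of \<open>L_space M P\<close>, it is unique only up to functions
  that pair to 0 with every member of \<open>P\<close>.
\<close>

definition is_expectation ::
  "'a measure \<Rightarrow> ('a set \<Rightarrow> real) set \<Rightarrow> 'w measure \<Rightarrow> ('w \<Rightarrow> ('a \<Rightarrow> real)) \<Rightarrow> ('a \<Rightarrow> real) \<Rightarrow> bool" where
  "is_expectation M P N Q m \<longleftrightarrow> m \<in> L_space M P \<and>
     (\<forall>p\<in>P. pairing M m p = (LINT w|N. pairing M (Q w) p))"

text \<open>The functional Bregman information of \<open>Q\<close>, where \<open>m\<close> is the expectation of \<open>Q\<close>.\<close>

definition bregman_information ::
  "(('a \<Rightarrow> real) \<Rightarrow> real) \<Rightarrow> 'w measure \<Rightarrow> ('w \<Rightarrow> ('a \<Rightarrow> real)) \<Rightarrow> ('a \<Rightarrow> real) \<Rightarrow> real" where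
  "bregman_information \<phi> N Q m = (LINT w|N. \<phi> (Q w)) - \<phi> m"

end

theory Submission
  imports Defs
begin

text \<open>
  For \<open>p \<in> P\<close> the subgradient inequality says precisely that \<open>p\<close> attains the supremum
  defining \<open>G\<^sup>*\<close> at \<open>S p\<close>, so that \<open>G\<^sup>* (S p) = S p \<cdot> p - G p\<close>. The conjugate is finite on
  the hull because it is a supremum of affine functions, and the Fenchel-Young inequality
  \<open>G\<^sup>* f \<ge> f \<cdot> p - G p\<close> becomes the subgradient inequality for \<open>p = S\<^sup>-\<^sup>1 (S p)\<close>. All identities
  are then consequences of the bilinearity of the pairing on \<open>L_space M P \<times> span P\<close>.
\<close>

section \<open>Bilinearity of the pairing\<close>

text \<open>Allows a sum of two differences of measures to be written as one difference, (A - B) +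
  (C - D) = (A + C) - (B + D).\<close>

definition sum_measure :: "'a measure \<Rightarrow> 'a measure \<Rightarrow> 'a measure" where
  "sum_measure A B = measure_of (space A) (sets A) (\<lambda>X. emeasure A X + emeasure B X)"

lemma sets_sum_measure [simp]: "sets (sum_measure A B) = sets A"
  by (simp add: sum_measure_def)

lemma emeasure_sum_measure:
  assumes "sets A = sets B"
  shows "emeasure (sum_measure A B) X = emeasure A X + emeasure B X"
proof (cases "X \<in> sets A")
  case True
  have "countably_additive (sets A) (\<lambda>X. emeasure A X + emeasure B X)"
    unfolding countably_additive_def
    by (auto simp: suminf_add[symmetric] suminf_emeasure assms)
  then show ?thesis
    unfolding sum_measure_def using True
    by (intro emeasure_measure_of_sigma) (auto simp: positive_def sets.sigma_algebra_axioms)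
next
  \<comment> \<open>All three values are 0 here. Covering such \<open>X\<close> makes
    \<open>measure_sum_measure\<close> an equality of set functions.\<close>
  case False
  then show ?thesis
    using assms by (simp add: emeasure_notin_sets)
qed

lemma finite_measure_sum_measure:
  assumes "sets A = sets B" "finite_measure A" "finite_measure B"
  shows "finite_measure (sum_measure A B)"
  by (rule finite_measureI)
    (use assms in \<open>simp add: emeasure_sum_measure finite_measure.emeasure_finite\<close>)

lemma measure_sum_measure:
  assumes "sets A = sets B" "finite_measure A" "finite_measure B"
  shows "measure (sum_measure A B) = measure A + measure B"
  using assms
  by (auto simp: fun_eq_iff measure_def emeasure_sum_measure finite_measure.emeasure_finite
      less_top[symmetric] intro!: enn2real_plus)

text \<open>Both parts come from the identities for four measures, with the null measure added to
  the sum: (A + B) + 0 = A + B.\<close>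

lemma
  fixes f :: "'a \<Rightarrow> real"
  assumes s: "sets A = sets B" and i: "integrable A f" "integrable B f"
  shows integrable_sum_measure: "integrable (sum_measure A B) f"
    and integral_sum_measure: "integral\<^sup>L (sum_measure A B) f = integral\<^sup>L A f + integral\<^sup>L B f"
proof -
  have f: "f \<in> borel_measurable A"
    using i(1) by simp
  have fs: "f \<in> borel_measurable (sum_measure A B)"
    using f by (simp cong: measurable_cong_sets)
  have "nn_integral (sum_measure A B) (\<lambda>x. ennreal (norm (f x)))
      + nn_integral (null_measure A) (\<lambda>x. ennreal (norm (f x)))
      = nn_integral A (\<lambda>x. ennreal (norm (f x))) + nn_integral B (\<lambda>x. ennreal (norm (f x)))"
    using s f by (intro nn_integral_sum_measures_eq[of _ A]) (auto simp: emeasure_sum_measure)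
  then show int: "integrable (sum_measure A B) f"
    using i fs by (simp add: integrable_iff_bounded)
  have "integral\<^sup>L (sum_measure A B) f + integral\<^sup>L (null_measure A) f = integral\<^sup>L A f + integral\<^sup>L B f"
    using s f i int by (intro integral_sum_measures_eq[of _ A]) (auto simp: emeasure_sum_measure)
  then show "integral\<^sup>L (sum_measure A B) f = integral\<^sup>L A f + integral\<^sup>L B f"
    by simp
qed

lemma finite_measure_scale_measure:
  assumes "finite_measure A"
  shows "finite_measure (scale_measure (ennreal c) A)"
  by (rule finite_measureI)
    (use assms in \<open>simp add: ennreal_mult_eq_top_iff finite_measure.emeasure_finite space_scale_measure\<close>)

text \<open>Scaling by a constant is a density with constant value, so the rules for densities
  apply.\<close>

lemma
  fixes f :: "'a \<Rightarrow> real"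
  assumes c: "0 \<le> c" and i: "integrable A f"
  shows integrable_scale_measure: "integrable (scale_measure (ennreal c) A) f"
    and integral_scale_measure: "integral\<^sup>L (scale_measure (ennreal c) A) f = c * integral\<^sup>L A f"
proof -
  have eq: "scale_measure (ennreal c) A = density A (\<lambda>_. ennreal c)"
    by (rule measure_eqI) (simp_all add: emeasure_density_const)
  show "integrable (scale_measure (ennreal c) A) f"
    unfolding eq using c i by (subst integrable_density) auto
  show "integral\<^sup>L (scale_measure (ennreal c) A) f = c * integral\<^sup>L A f"
    unfolding eq using c i by (subst integral_density) auto
qed

section \<open>Signed measures as differences of finite measures\<close>

text \<open>In \<open>pairing\<close> the decomposition may vary with the function. Here one pair
  serves all of \<open>F\<close> at once, so that \<open>f\<close>, \<open>g\<close> and their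
  combinations can be integrated against the same two measures.\<close>

definition signed_decomposition ::
  "'a measure \<Rightarrow> ('a \<Rightarrow> real) set \<Rightarrow> ('a set \<Rightarrow> real) \<Rightarrow> 'a measure \<Rightarrow> 'a measure \<Rightarrow> bool" where
  "signed_decomposition M F \<mu> A B \<longleftrightarrow>
     finite_measure A \<and> sets A = sets M \<and> finite_measure B \<and> sets B = sets M \<and>
     (\<forall>f\<in>F. integrable A f \<and> integrable B f) \<and> \<mu> = measure A - measure B"

lemma pairing_signed_decomposition:
  assumes "signed_decomposition M F \<mu> A B" "f \<in> F"
  shows "pairing M f \<mu> = integral\<^sup>L A f - integral\<^sup>L B f"
  using assms unfolding signed_decomposition_def by (intro pairing_eq) auto

lemma signed_decomposition_add:
  assumes "signed_decomposition M F \<mu> A B" "signed_decomposition M F \<kappa> C D"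
  shows "signed_decomposition M F (\<mu> + \<kappa>) (sum_measure A C) (sum_measure B D)"
  using assms unfolding signed_decomposition_def
  by (simp add: finite_measure_sum_measure measure_sum_measure integrable_sum_measure)

lemma signed_decomposition_scaleR:
  assumes "0 \<le> c" "signed_decomposition M F \<mu> A B"
  shows "signed_decomposition M F (c *\<^sub>R \<mu>)
    (scale_measure (ennreal c) A) (scale_measure (ennreal c) B)"
  using assms unfolding signed_decomposition_def
  by (simp add: finite_measure_scale_measure integrable_scale_measure fun_eq_iff measure_def
      enn2real_mult right_diff_distrib)

lemma signed_decomposition_uminus:
  assumes "signed_decomposition M F \<mu> A B"
  shows "signed_decomposition M F (- \<mu>) B A"
  using assms unfolding signed_decomposition_def by simp

lemma pairing_add_right:
  assumes "signed_decomposition M F \<mu> A B" "signed_decomposition M F \<kappa> C D" "f \<in> F"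
  shows "pairing M f (\<mu> + \<kappa>) = pairing M f \<mu> + pairing M f \<kappa>"
  unfolding pairing_signed_decomposition[OF assms(1,3)] pairing_signed_decomposition[OF assms(2,3)]
    pairing_signed_decomposition[OF signed_decomposition_add[OF assms(1,2)] assms(3)]
  using assms unfolding signed_decomposition_def by (simp add: integral_sum_measure)

text \<open>A negative factor is handled by exchanging the two parts, since c \<mu> = (-c)(-\<mu>).
  The witnesses depend on the sign of \<open>c\<close>; the equation for the integrals hides this
  case distinction from later use.\<close>

lemma signed_decomposition_scaleR_ex:
  assumes "signed_decomposition M F \<mu> A B"
  shows "\<exists>C D. signed_decomposition M F (c *\<^sub>R \<mu>) C D \<and>
    (\<forall>f\<in>F. integral\<^sup>L C f - integral\<^sup>L D f = c * (integral\<^sup>L A f - integral\<^sup>L B f))"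
proof (cases "0 \<le> c")
  case True
  then show ?thesis
    using signed_decomposition_scaleR[OF True assms] assms
    by (intro exI[of _ "scale_measure (ennreal c) A"] exI[of _ "scale_measure (ennreal c) B"])
      (auto simp: signed_decomposition_def integral_scale_measure right_diff_distrib)
next
  case False
  then have c: "0 \<le> - c" by simp
  have "signed_decomposition M F (- c *\<^sub>R - \<mu>)
      (scale_measure (ennreal (- c)) B) (scale_measure (ennreal (- c)) A)"
    by (rule signed_decomposition_scaleR[OF c signed_decomposition_uminus[OF assms]])
  then show ?thesis
    using assms c
    by (intro exI[of _ "scale_measure (ennreal (- c)) B"] exI[of _ "scale_measure (ennreal (- c)) A"])
      (auto simp: signed_decomposition_def integral_scale_measure right_diff_distrib)
qed

lemma pairing_scaleR_right:
  assumes "signed_decomposition M F \<mu> A B" "f \<in> F"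
  shows "pairing M f (c *\<^sub>R \<mu>) = c * pairing M f \<mu>"
proof -
  obtain C D where CD: "signed_decomposition M F (c *\<^sub>R \<mu>) C D"
    and eq: "\<forall>f\<in>F. integral\<^sup>L C f - integral\<^sup>L D f = c * (integral\<^sup>L A f - integral\<^sup>L B f)"
    using signed_decomposition_scaleR_ex[OF assms(1)] by blast
  show ?thesis
    using eq assms(2)
    by (simp add: pairing_signed_decomposition[OF CD] pairing_signed_decomposition[OF assms(1)])
qed

text \<open>A generator is a probability measure minus the null measure, and \<open>L_space\<close>
  is defined so that all its members are integrable; sums and multiples preserve decomposability.
  Hence \<open>pairing\<close> is meaningful on the whole span.\<close>

lemma span_signed_decomposition:
  assumes P: "P \<subseteq> prob_measures M" and \<mu>: "\<mu> \<in> span P"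
  shows "\<exists>A B. signed_decomposition M (L_space M P) \<mu> A B"
  using \<mu>
proof (induction rule: span_induct_alt)
  case base
  have "signed_decomposition M (L_space M P) 0 (null_measure M) (null_measure M)"
    by (auto simp: signed_decomposition_def L_space_def fun_eq_iff intro!: finite_measureI)
  then show ?case by blast
next
  case (step c x y)
  obtain p where p: "prob_space p" "sets p = sets M" "x = measure p"
    using step(1) P by (auto simp: prob_measures_def)
  have "\<forall>f \<in> L_space M P. integrable p f"
    using p step(1) by (auto simp: L_space_def)
  then have "signed_decomposition M (L_space M P) x p (null_measure M)"
    using p
    by (auto simp: signed_decomposition_def L_space_def fun_eq_iff prob_space.finite_measure
        prob_space_def intro!: finite_measureI)
  then obtain C D where "signed_decomposition M (L_space M P) (c *\<^sub>R x) C D"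
    using signed_decomposition_scaleR_ex by blast
  moreover obtain A B where "signed_decomposition M (L_space M P) y A B"
    using step(2) by blast
  ultimately show ?case
    using signed_decomposition_add by blast
qed

section \<open>Functions and signed measures as a dual pair\<close>

lemma L_spaceI_combination:
  assumes "f \<in> L_space M P" "g \<in> L_space M P"
  shows "c *\<^sub>R f + d *\<^sub>R g \<in> L_space M P"
  using assms by (auto simp: L_space_def plus_fun_def scaleR_fun_def)

lemma subspace_L_space: "subspace (L_space M P)"
proof (rule subspaceI)
  show "0 \<in> L_space M P"
    by (auto simp: L_space_def zero_fun_def)
  show "f + g \<in> L_space M P" if "f \<in> L_space M P" "g \<in> L_space M P" for f g
    using L_spaceI_combination[OF that, of 1 1] by simp
  show "c *\<^sub>R f \<in> L_space M P" if "f \<in> L_space M P" for c f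
    using L_spaceI_combination[OF that that, of c 0] by simp
qed

text \<open>Functions are the points and measures the functionals, as the divergence of the
  conjugate requires; hence the exchanged arguments of \<open>pairing\<close>. Linearity in the
  function uses a common decomposition of \<mu>, linearity in the measure uses operations on
  decompositions.\<close>

lemma dual_pair_pairing:
  assumes P: "P \<subseteq> prob_measures M"
  shows "dual_pair (L_space M P) (span P) (\<lambda>\<mu> f. pairing M f \<mu>)"
  unfolding dual_pair_def
proof (intro conjI ballI allI)
  fix \<mu> f g and c d :: real
  assume \<mu>: "\<mu> \<in> span P" and fg: "f \<in> L_space M P" "g \<in> L_space M P"
  obtain A B where AB: "signed_decomposition M (L_space M P) \<mu> A B"
    using span_signed_decomposition[OF P \<mu>] by blast
  have "integral\<^sup>L K (c *\<^sub>R f + d *\<^sub>R g) = c * integral\<^sup>L K f + d * integral\<^sup>L K g"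
    if "integrable K f" "integrable K g" for K
    using that by (simp add: plus_fun_def scaleR_fun_def)
  with AB fg show "pairing M (c *\<^sub>R f + d *\<^sub>R g) \<mu> = c * pairing M f \<mu> + d * pairing M g \<mu>"
    unfolding pairing_signed_decomposition[OF AB fg(1)] pairing_signed_decomposition[OF AB fg(2)]
      pairing_signed_decomposition[OF AB L_spaceI_combination[OF fg]]
    by (simp add: signed_decomposition_def algebra_simps)
next
  fix \<mu> \<kappa> f and c d :: real
  assume "\<mu> \<in> span P" "\<kappa> \<in> span P" and f: "f \<in> L_space M P"
  then obtain A B C D where AB: "signed_decomposition M (L_space M P) \<mu> A B"
    and CD: "signed_decomposition M (L_space M P) \<kappa> C D"
    using span_signed_decomposition[OF P] by meson
  obtain A' B' where AB': "signed_decomposition M (L_space M P) (c *\<^sub>R \<mu>) A' B'"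
    using signed_decomposition_scaleR_ex[OF AB] by blast
  obtain C' D' where CD': "signed_decomposition M (L_space M P) (d *\<^sub>R \<kappa>) C' D'"
    using signed_decomposition_scaleR_ex[OF CD] by blast
  show "pairing M f (c *\<^sub>R \<mu> + d *\<^sub>R \<kappa>) = c * pairing M f \<mu> + d * pairing M f \<kappa>"
    unfolding pairing_add_right[OF AB' CD' f] pairing_scaleR_right[OF AB f]
      pairing_scaleR_right[OF CD f] ..
qed (auto intro: subspace_L_space subspace_span)

lemma dual_pair_diff_left:
  assumes "dual_pair X X' b" "u \<in> X'" "v \<in> X'" "x \<in> X"
  shows "b (u - v) x = b u x - b v x"
proof -
  have "b (1 *\<^sub>R u + (- 1) *\<^sub>R v) x = 1 * b u x + (- 1) * b v x"
    using assms unfolding dual_pair_def by blast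
  then show ?thesis by simp
qed

lemma dual_pair_diff_right:
  assumes "dual_pair X X' b" "u \<in> X'" "x \<in> X" "y \<in> X"
  shows "b u (x - y) = b u x - b u y"
proof -
  have "b u (1 *\<^sub>R x + (- 1) *\<^sub>R y) = 1 * b u x + (- 1) * b u y"
    using assms unfolding dual_pair_def by blast
  then show ?thesis by simp
qed

section \<open>The conjugate\<close>

text \<open>Outside \<open>P\<close> the term is a real number minus \<infinity>, that is
  -\<infinity>, and cannot raise the supremum.\<close>

lemma conjugate_eq:
  "conjugate M P G f = (SUP \<mu>\<in>P. ereal (pairing M f \<mu> - G \<mu>))"
  unfolding conjugate_def
proof (rule antisym)
  show "(SUP \<mu>\<in>span P. ereal (pairing M f \<mu>) - (if \<mu> \<in> P then ereal (G \<mu>) else \<infinity>))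
      \<le> (SUP \<mu>\<in>P. ereal (pairing M f \<mu> - G \<mu>))"
    by (rule SUP_least) (auto intro: SUP_upper)
  show "(SUP \<mu>\<in>P. ereal (pairing M f \<mu> - G \<mu>))
      \<le> (SUP \<mu>\<in>span P. ereal (pairing M f \<mu>) - (if \<mu> \<in> P then ereal (G \<mu>) else \<infinity>))"
  proof (rule SUP_least)
    fix \<mu> assume "\<mu> \<in> P"
    then show "ereal (pairing M f \<mu> - G \<mu>)
      \<le> (SUP \<mu>\<in>span P. ereal (pairing M f \<mu>) - (if \<mu> \<in> P then ereal (G \<mu>) else \<infinity>))"
      by (intro SUP_upper2[of \<mu>]) (auto intro: span_base)
  qed
qed

lemma conjugate_le_iff:
  "conjugate M P G f \<le> ereal r \<longleftrightarrow> (\<forall>\<mu>\<in>P. pairing M f \<mu> - G \<mu> \<le> r)"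
  by (simp add: conjugate_eq SUP_le_iff)

text \<open>The term at \<open>p\<close> is a real lower bound, which excludes -\<infinity>; the
  second hypothesis excludes \<infinity>.\<close>

lemma conjugate_finite:
  assumes "p \<in> P" "conjugate M P G f < \<infinity>"
  shows "conjugate M P G f = ereal (conjugate_real M P G f)"
proof -
  have "ereal (pairing M f p - G p) \<le> conjugate M P G f"
    unfolding conjugate_eq using assms(1) by (rule SUP_upper)
  with assms(2) show ?thesis
    unfolding conjugate_real_def by (cases "conjugate M P G f") auto
qed

text \<open>Finiteness matters because \<open>real_of_ereal\<close> sends infinite values to
  0.\<close>

lemma fenchel_young:
  assumes "p \<in> P" "conjugate M P G f < \<infinity>"
  shows "pairing M f p - G p \<le> conjugate_real M P G f"
  using conjugate_finite[OF assms] conjugate_le_iff[of M P G f "conjugate_real M P G f"] assms(1)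
  by simp

text \<open>Each term of the supremum is affine in the function, so at the combination it is the
  combination of two terms, each bounded by \<open>fenchel_young\<close>. This gives both convexity
  of the domain of finiteness and convexity of the conjugate.\<close>

lemma conjugate_combination_le:
  assumes dp: "dual_pair (L_space M P) (span P) (\<lambda>\<mu> f. pairing M f \<mu>)"
    and f: "f \<in> L_space M P" "conjugate M P G f < \<infinity>"
    and g: "g \<in> L_space M P" "conjugate M P G g < \<infinity>"
    and uv: "0 \<le> u" "0 \<le> v" "u + v = 1"
  shows "conjugate M P G (u *\<^sub>R f + v *\<^sub>R g)
    \<le> ereal (u * conjugate_real M P G f + v * conjugate_real M P G g)"
  unfolding conjugate_le_iff
proof
  fix \<mu> assume \<mu>: "\<mu> \<in> P"
  have "pairing M (u *\<^sub>R f + v *\<^sub>R g) \<mu> - G \<mu> = u * (pairing M f \<mu> - G \<mu>) + v * (pairing M g \<mu> - G \<mu>)"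
  proof -
    have "pairing M (u *\<^sub>R f + v *\<^sub>R g) \<mu> = u * pairing M f \<mu> + v * pairing M g \<mu>"
      using dp f(1) g(1) span_base[OF \<mu>] unfolding dual_pair_def by blast
    moreover have "u * G \<mu> + v * G \<mu> = G \<mu>"
      using uv(3) by (simp add: distrib_right[symmetric])
    ultimately show ?thesis by (simp add: right_diff_distrib)
  qed
  also have "\<dots> \<le> u * conjugate_real M P G f + v * conjugate_real M P G g"
    using fenchel_young[OF \<mu> f(2)] fenchel_young[OF \<mu> g(2)] uv
    by (intro add_mono mult_left_mono)
  finally show "pairing M (u *\<^sub>R f + v *\<^sub>R g) \<mu> - G \<mu>
    \<le> u * conjugate_real M P G f + v * conjugate_real M P G g" .
qed

text \<open>Carries finiteness from the image of \<open>S\<close> to its convex hull.\<close>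

lemma convex_conjugate_domain:
  assumes "dual_pair (L_space M P) (span P) (\<lambda>\<mu> f. pairing M f \<mu>)"
  shows "convex {f \<in> L_space M P. conjugate M P G f < \<infinity>}"
proof (rule convexI)
  fix f g and u v :: real
  assume *: "f \<in> {f \<in> L_space M P. conjugate M P G f < \<infinity>}"
    "g \<in> {f \<in> L_space M P. conjugate M P G f < \<infinity>}" and uv: "0 \<le> u" "0 \<le> v" "u + v = 1"
  then have "conjugate M P G (u *\<^sub>R f + v *\<^sub>R g)
      \<le> ereal (u * conjugate_real M P G f + v * conjugate_real M P G g)"
    by (intro conjugate_combination_le[OF assms]) auto
  with * show "u *\<^sub>R f + v *\<^sub>R g \<in> {f \<in> L_space M P. conjugate M P G f < \<infinity>}"
    by (auto intro: L_spaceI_combination simp: less_top[symmetric])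
qed

section \<open>The conjugate at subgradients of \<open>G\<close>\<close>

text \<open>The equality case of Fenchel-Young: splitting the pairing with \<open>q - p\<close>
  turns the subgradient inequality into a comparison of the terms at \<open>q\<close> and at
  \<open>p\<close>.\<close>

lemma conjugate_subgradient:
  assumes dp: "dual_pair (L_space M P) (span P) (\<lambda>\<mu> f. pairing M f \<mu>)"
    and sub: "subgradient_on (L_space M P) (pairing M) P P G S" and p: "p \<in> P"
  shows "conjugate M P G (S p) = ereal (pairing M (S p) p - G p)"
proof (rule antisym)
  show "conjugate M P G (S p) \<le> ereal (pairing M (S p) p - G p)"
    unfolding conjugate_le_iff
  proof
    fix q assume q: "q \<in> P"
    have "S p \<in> L_space M P" "G q \<ge> G p + pairing M (S p) (q - p)"
      using sub p q unfolding subgradient_on_def by auto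
    then show "pairing M (S p) q - G q \<le> pairing M (S p) p - G p"
      using dual_pair_diff_left[OF dp span_base[OF q] span_base[OF p]] by simp
  qed
  show "ereal (pairing M (S p) p - G p) \<le> conjugate M P G (S p)"
    unfolding conjugate_eq using p by (rule SUP_upper)
qed

text \<open>If \<open>S p = S q\<close>, then both \<open>p\<close> and \<open>q\<close> maximize
  \<mu> \<mapsto> \<open>pairing M (S p)\<close> \<mu> - \<open>G\<close> \<mu> over
  \<open>P\<close>, but by strict convexity the midpoint would give a larger value.\<close>

lemma subgradient_inj_on:
  assumes dp: "dual_pair (L_space M P) (span P) (\<lambda>\<mu> f. pairing M f \<mu>)"
    and sc: "strict_convex_on P G"
    and sub: "subgradient_on (L_space M P) (pairing M) P P G S"
  shows "inj_on S P"
proof (rule inj_onI, rule ccontr)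
  fix p q assume p: "p \<in> P" and q: "q \<in> P" and eq: "S p = S q" and ne: "p \<noteq> q"
  \<comment> \<open>The midpoint, written with \<open>1 - 1/2\<close> to match
    \<open>strict_convex_on\<close> at \<open>t = 1/2\<close>.\<close>
  define r where "r = (1 - 1/2) *\<^sub>R p + (1/2) *\<^sub>R q"
  have "convex P" using sc by (simp add: strict_convex_on_def)
  then have r: "r \<in> P" unfolding r_def using p q by (intro convexD) auto
  have lt: "G r < (1 - 1/2) * G p + (1/2) * G q"
  proof -
    have "\<forall>t. p \<noteq> q \<and> 0 < t \<and> t < 1 \<longrightarrow>
        G ((1 - t) *\<^sub>R p + t *\<^sub>R q) < (1 - t) * G p + t * G q"
      using sc p q unfolding strict_convex_on_def by blast
    then show ?thesis
      unfolding r_def using ne by (elim allE[of _ "1/2"]) simp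
  qed
  have L: "S p \<in> L_space M P"
    using sub p unfolding subgradient_on_def by auto
  have "pairing M (S p) r = (1 - 1/2) * pairing M (S p) p + (1/2) * pairing M (S p) q"
    using dp L span_base[OF p] span_base[OF q] unfolding dual_pair_def r_def by blast
  \<comment> \<open>The value of the conjugate, read as an upper bound, bounds the term at
    \<open>r\<close>.\<close>
  moreover have "pairing M (S p) r - G r \<le> pairing M (S p) p - G p"
    using conjugate_le_iff[THEN iffD1, OF eq_refl[OF conjugate_subgradient[OF dp sub p]]] r
    by blast
  moreover have "pairing M (S p) r - G r \<le> pairing M (S p) q - G q"
    using conjugate_le_iff[THEN iffD1, OF eq_refl[OF conjugate_subgradient[OF dp sub q]]] r
    unfolding eq by blast
  ultimately show False using lt by simp
qed

section \<open>Well-definedness, duality and the expected divergence\<close>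

text \<open>The first three conjuncts express well-definedness: \<open>inv_into P S\<close> is a
  genuine inverse on the image, and \<open>conjugate_real\<close> agrees with the conjugate on the
  hull. Integrability is part of the last conclusion, since a non-integrable function would have the
  default integral 0.\<close>

theorem lemma3p1:
  fixes M :: "'a measure"
    and P :: "('a set \<Rightarrow> real) set"
    and T :: "('a set \<Rightarrow> real) topology"
    and G :: "('a set \<Rightarrow> real) \<Rightarrow> real"
    and S :: "('a set \<Rightarrow> real) \<Rightarrow> ('a \<Rightarrow> real)"
  assumes "P \<subseteq> prob_measures M"
    and "convex P"
    and "topspace T = span P"
    and "strict_convex_on P G"
    and "lower_semicontinuous (subtopology T P) G"
    and "subgradient_on (L_space M P) (pairing M) P P G S"
  shows "inj_on S P
    \<and> (\<forall>f \<in> convex hull (S ` P). \<bar>conjugate M P G f\<bar> \<noteq> \<infinity>)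
    \<and> restricted_bregman (L_space M P) (span P) (\<lambda>\<mu> f. pairing M f \<mu>)
        (convex hull (S ` P)) (S ` P) (conjugate_real M P G) (inv_into P S)
    \<and> (\<forall>p\<in>P. \<forall>q\<in>P. bregman_primal M G S p q = bregman_conjugate M P G S (S q) (S p))
    \<and> (\<forall>p' \<in> S ` P. \<forall>q' \<in> S ` P.
        bregman_conjugate M P G S p' q' = bregman_primal M G S (inv_into P S q') (inv_into P S p'))
    \<and> (\<forall>p' \<in> S ` P. \<forall>(N :: 'w measure) Q m.
        prob_space N
        \<and> (\<forall>w \<in> space N. Q w \<in> S ` P)
        \<and> (\<forall>p\<in>P. integrable N (\<lambda>w. pairing M (Q w) p))
        \<and> is_expectation M P N Q m \<and> m \<in> convex hull (S ` P)
        \<and> integrable N (\<lambda>w. conjugate_real M P G (Q w))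
        \<longrightarrow> integrable N (\<lambda>w. bregman_conjugate M P G S p' (Q w))
          \<and> (LINT w|N. bregman_conjugate M P G S p' (Q w))
            = bregman_information (conjugate_real M P G) N Q m + bregman_conjugate M P G S p' m)"
proof -
  note sub = assms(6)
  have dp: "dual_pair (L_space M P) (span P) (\<lambda>\<mu> f. pairing M f \<mu>)"
    by (rule dual_pair_pairing[OF assms(1)])
  have inj: "inj_on S P"
    by (rule subgradient_inj_on[OF dp assms(4) sub])
  have SL: "S p \<in> L_space M P" if "p \<in> P" for p
    using sub that unfolding subgradient_on_def by auto
  have conjS: "conjugate_real M P G (S p) = pairing M (S p) p - G p" if "p \<in> P" for p
    using conjugate_subgradient[OF dp sub that] by (simp add: conjugate_real_def)
  have hull: "convex hull (S ` P) \<subseteq> {f \<in> L_space M P. conjugate M P G f < \<infinity>}"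
  proof (rule hull_minimal)
    show "convex {f \<in> L_space M P. conjugate M P G f < \<infinity>}"
      by (rule convex_conjugate_domain[OF dp])
  qed (auto simp: SL conjugate_subgradient[OF dp sub])
  have fin: "conjugate M P G f = ereal (conjugate_real M P G f)" if f: "f \<in> convex hull (S ` P)" for f
  proof -
    \<comment> \<open>A point of the hull forces \<open>P\<close> to be nonempty, which excludes the
      value -\<infinity>.\<close>
    obtain p where "p \<in> P"
      using f by (cases "P = {}") auto
    then show ?thesis using f hull by (intro conjugate_finite) auto
  qed
  have pd: "pairing M (f - g) p = pairing M f p - pairing M g p"
    if "f \<in> L_space M P" "g \<in> L_space M P" "p \<in> P" for f g p
    using dual_pair_diff_right[OF dp] that span_base[of p P] by blast
  have convex: "convex_on (convex hull (S ` P)) (conjugate_real M P G)"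
  proof (rule convex_onI)
    fix t :: real and f g
    assume t: "0 < t" "t < 1" and fg: "f \<in> convex hull (S ` P)" "g \<in> convex hull (S ` P)"
    \<comment> \<open>Membership in the hull lets \<open>fin\<close> turn the extended-real bound
      below into a real one.\<close>
    have "(1 - t) *\<^sub>R f + t *\<^sub>R g \<in> convex hull (S ` P)"
      using t fg by (intro convexD[OF convex_convex_hull]) auto
    moreover have "conjugate M P G ((1 - t) *\<^sub>R f + t *\<^sub>R g)
        \<le> ereal ((1 - t) * conjugate_real M P G f + t * conjugate_real M P G g)"
      using t fg hull by (intro conjugate_combination_le[OF dp]) auto
    ultimately show "conjugate_real M P G ((1 - t) *\<^sub>R f + t *\<^sub>R g)
        \<le> (1 - t) * conjugate_real M P G f + t * conjugate_real M P G g"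
      using fin by simp
  qed simp
  have subconj: "subgradient_on (span P) (\<lambda>\<mu> f. pairing M f \<mu>) (convex hull (S ` P)) (S ` P)
      (conjugate_real M P G) (inv_into P S)"
    unfolding subgradient_on_def
  proof (intro conjI ballI)
    show "inv_into P S \<in> S ` P \<rightarrow> span P"
      by (auto intro: span_base inv_into_into)
  next
    fix f g assume "f \<in> S ` P" and g: "g \<in> convex hull (S ` P)"
    then obtain p where p: "p \<in> P" "f = S p" by auto
    \<comment> \<open>Subtracting the equality \<open>conjS\<close> at \<open>p\<close> from this
      inequality leaves the subgradient inequality with slope \<open>p\<close>.\<close>
    have "pairing M g p - G p \<le> conjugate_real M P G g"
      using g hull p by (intro fenchel_young) auto
    then show "conjugate_real M P G f + pairing M (g - f) (inv_into P S f) \<le> conjugate_real M P G g"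
      using p g hull by (auto simp: inv_into_f_f[OF inj] conjS pd SL)
  qed
  \<comment> \<open>The two occurrences of \<open>pairing M (S p) p\<close> cancel. What remains
    involves \<open>f\<close> only through its conjugate and its pairing with the fixed measure
    \<open>p\<close>; the duality and the expectation formula both rest on this.\<close>
  have conj_bregman: "bregman_conjugate M P G S (S p) f =
      conjugate_real M P G f - pairing M f p + G p" if "p \<in> P" "f \<in> L_space M P" for p f
    using that
    by (simp add: bregman_conjugate_def bregman_def inv_into_f_f[OF inj] conjS pd SL)
  \<comment> \<open>With base point \<open>S q\<close> and argument \<open>S p\<close>,
    \<open>conj_bregman\<close> and \<open>conjS\<close> give S(p).p - G(p) - S(p).q + G(q).\<close>
  have duality: "bregman_primal M G S p q = bregman_conjugate M P G S (S q) (S p)"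
    if "p \<in> P" "q \<in> P" for p q
    using that dual_pair_diff_left[OF dp span_base span_base SL]
    by (simp add: conj_bregman conjS SL bregman_primal_def bregman_def)
  have expect: "integrable N (\<lambda>w. bregman_conjugate M P G S p' (Q w))
      \<and> (LINT w|N. bregman_conjugate M P G S p' (Q w))
        = bregman_information (conjugate_real M P G) N Q m + bregman_conjugate M P G S p' m"
    if p': "p' \<in> S ` P" and N: "prob_space N" and Q: "\<forall>w \<in> space N. Q w \<in> S ` P"
      and iQ: "\<forall>p\<in>P. integrable N (\<lambda>w. pairing M (Q w) p)"
      and m: "is_expectation M P N Q m" and iG: "integrable N (\<lambda>w. conjugate_real M P G (Q w))"
    for p' m Q and N :: "'w measure"
  proof -
    interpret prob_space N by fact
    obtain p where p: "p \<in> P" "p' = S p" using p' by auto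
    \<comment> \<open>The values of \<open>Q\<close> are controlled only on \<open>space N\<close>,
      which suffices for integrals over \<open>N\<close>.\<close>
    have eq: "bregman_conjugate M P G S p' (Q w) =
        conjugate_real M P G (Q w) - pairing M (Q w) p + G p" if "w \<in> space N" for w
      using Q that p SL by (auto intro!: conj_bregman)
    have i: "integrable N (\<lambda>w. conjugate_real M P G (Q w) - pairing M (Q w) p + G p)"
      using iQ iG p by simp
    have "(LINT w|N. bregman_conjugate M P G S p' (Q w))
        = (LINT w|N. conjugate_real M P G (Q w) - pairing M (Q w) p + G p)"
      by (intro Bochner_Integration.integral_cong) (simp_all add: eq)
    \<comment> \<open>The constant \<open>G p\<close> is its own integral because \<open>N\<close>
      has total mass 1; the mean of the pairings is the pairing with \<open>m\<close>.\<close>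
    also have "\<dots> = (LINT w|N. conjugate_real M P G (Q w)) - pairing M m p + G p"
      using iQ iG p m by (simp add: is_expectation_def prob_space)
    \<comment> \<open>Add and subtract the conjugate at \<open>m\<close>, then read
      \<open>conj_bregman\<close> backwards at \<open>m\<close>, which lies in
      \<open>L_space M P\<close>.\<close>
    also have "\<dots> = bregman_information (conjugate_real M P G) N Q m + bregman_conjugate M P G S p' m"
      using m p by (simp add: is_expectation_def bregman_information_def conj_bregman)
    finally show ?thesis
      using i by (simp add: eq cong: Bochner_Integration.integrable_cong)
  qed
  show ?thesis
  proof (intro conjI)
    show "restricted_bregman (L_space M P) (span P) (\<lambda>\<mu> f. pairing M f \<mu>)
        (convex hull (S ` P)) (S ` P) (conjugate_real M P G) (inv_into P S)"
      using dp hull convex subconj hull_subset[of "S ` P" convex]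
      unfolding restricted_bregman_def by blast
    show "\<forall>f \<in> convex hull (S ` P). \<bar>conjugate M P G f\<bar> \<noteq> \<infinity>"
      by (auto dest: fin)
    \<comment> \<open>This is \<open>duality\<close> at the preimages, with the roles exchanged:
      \<open>p\<close> is the preimage of \<open>q'\<close> and \<open>q\<close> that of
      \<open>p'\<close>.\<close>
    show "\<forall>p' \<in> S ` P. \<forall>q' \<in> S ` P.
        bregman_conjugate M P G S p' q' = bregman_primal M G S (inv_into P S q') (inv_into P S p')"
      using duality by (auto simp: inv_into_f_f[OF inj])
    show "inj_on S P" by (rule inj)
    show "\<forall>p\<in>P. \<forall>q\<in>P. bregman_primal M G S p q = bregman_conjugate M P G S (S q) (S p)"
      using duality by blast
  qed (rule ballI, intro allI impI, rule expect; (elim conjE)?; assumption)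
qed

end
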